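(* Let $k\ge1$ be an integer with $k\le 2d_0^2/(\lambda\bar\varepsilon)$ and let $x_0=\hat x_{k-1}$ be the prox center of the $k$-th cycle of PDPB$(\hat x_0,\lambda,\bar\varepsilon)$. Let $\{z_j\}$ and $\{x_j\}$ be generated by either the two-cuts CG variant or the multi-cuts CG variant described in the context. Let $\{\tilde x_j\}$ be any sequence with $\tilde x_1=x_1$ and $$\phi^\lambda(\tilde x_{j+1})\le\frac{j}{j+2}\phi^\lambda(\tilde x_j)+\frac{2}{j+2}\phi^\lambda(x_{j+1}),\qquad j\ge1.$$ Then for every $j\ge1$, $$\phi^\lambda(\tilde x_j)+\psi(z_j)\le\frac{8M(3d_0+\lambda M)}{j(j+1)}+\frac{16\lambda M^2}{j+1}.$$
   Context: Problem. $f,h:\mathbb R^n\to\mathbb R\cup\{+\infty\}$ are proper lower semicontinuous convex functions with $\operatorname{dom}h\subset\operatorname{dom}f$, and $\phi=f+h$. Assumptions: there is a map $f':\operatorname{dom}h\to\mathbb R^n$ with $f'(x)\in\partial f(x)$ for all $x\in\operatorname{dom}h$; $\|f'(x)\|\le M$ for all $x\in\operatorname{dom}h$, for some $M>0$; the set $X_*$ of minimizers of $\phi$ is nonempty. Write $\ell_f(u;y)=f(y)+\langle f'(y),u-y\rangle$; $g^*$ is the convex conjugate of $g$. For $\hat x_0\in\operatorname{dom}h$ let $d_0=\min\{\|x_*-\hat x_0\|:x_*\in X_*\}$; $\lambda,\bar\varepsilon>0$. For a prox center $x_0\in\operatorname{dom}h$ let $h^\lambda(u)=h(u)+\frac1{2\lambda}\|u-x_0\|^2$,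 $\phi^\lambda=f+h^\lambda$, $\psi(z)=(h^\lambda)^*(-z)+f^*(z)$. PDCP$(x_0,\lambda,\varepsilon)$ (primal-dual cutting-plane): start with $\Gamma_1=\ell_f(\cdot;x_0)$. For $j=1,2,\dots$: $x_j=\operatorname{argmin}_u\{\Gamma_j(u)+h^\lambda(u)\}$ with minimum value $m_j$, and $s_j\in\partial\Gamma_j(x_j)\cap(-\partial h^\lambda(x_j))$; a point $\tilde x_j$ is chosen with $\tilde x_1=x_1$ and $\phi^\lambda(\tilde x_j)\le\tau_{j-1}\phi^\lambda(\tilde x_{j-1})+(1-\tau_{j-1})\phi^\lambda(x_j)$ for $j\ge2$; $t_j=\phi^\lambda(\tilde x_j)-m_j$; $\tau_j\in[0,1]$ is selected and $\Gamma_{j+1}$ is any proper lower semicontinuous convex function with $\Gamma_{j+1}\le f$ and $\Gamma_{j+1}\ge\tau_j\bar\Gamma_j+(1-\tau_j)\ell_f(\cdot;x_j)$ for some proper lower semicontinuous convex $\bar\Gamma_j\le f$ with $\bar\Gamma_j(x_j)=\Gamma_j(x_j)$ and $x_j=\operatorname{argmin}_u\{\bar\Gamma_j(u)+h^\lambda(u)\}$. It stops at the first $j$ with $t_j\le\varepsilon$ and returns $(x_j,\tilde x_j,s_j)$. PDPB$(\hat x_0,\lambda,\bar\varepsilon)$: for $k=1,2,\dots$, $(\hat x_k,\tilde x_k,s_k)=\text{PDCP}(\hat x_{k-1},\lambda,\bar\varepsilon)$. Two-cuts CG variant (with prox center $x_0$): let $\bar\Gamma_0=\ell_f(\cdot;x_0)$.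 For $j=1,2,\dots$: let $\Gamma_j=\max\{\bar\Gamma_{j-1},\ell_f(\cdot;x_{j-1})\}$; let $(x_j,\Gamma_j(x_j))$ be the optimal solution of $\min_{(u,r)\in\mathbb R^n\times\mathbb R}\{r+h^\lambda(u):\bar\Gamma_{j-1}(u)\le r,\ \ell_f(u;x_{j-1})\le r\}$ and let $\theta_{j-1}\in[0,1]$ be a Lagrange multiplier of the first constraint ($1-\theta_{j-1}$ being that of the second); set $\bar\Gamma_j=\theta_{j-1}\bar\Gamma_{j-1}+(1-\theta_{j-1})\ell_f(\cdot;x_{j-1})$ and $z_j=\nabla\bar\Gamma_j$. Thus $z_1=f'(x_0)$ and, with $\bar z_j=f'(x_j)$, for $j\ge2$ $z_j=\theta_{j-1}z_{j-1}+(1-\theta_{j-1})\bar z_{j-1}$; moreover $x_j=\nabla(h^\lambda)^*(-z_j)$ and $\theta_{j-1}\bar\Gamma_{j-1}(x_j)+(1-\theta_{j-1})\ell_f(x_j;x_{j-1})=\Gamma_j(x_j)$ for all $j\ge 1$. Multi-cuts CG variant (with prox center $x_0$): let $I_1=\{0\}$, $\bar z_0=z_1=f'(x_0)$. For $j=1,2,\dots$: let $\Gamma_j=\max\{\ell_f(\cdot;x_i):i\in I_j\}$; let $(x_j,\Gamma_j(x_j))$ be the optimal solution of $\min_{(u,r)\in\mathbb R^n\times\mathbb R}\{r+h^\lambda(u):\ell_f(u;x_i)\le r\ \forall i\in I_j\}$ with Lagrange multipliers $\theta_j^i\ge0$, $\sum_{i\in I_j}\theta_j^i=1$; set $z_j=\sum_{i\in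 I_j}\theta_j^i\bar z_i$, $\bar z_j=f'(x_j)$ (and $x_j=\nabla(h^\lambda)^*(-z_j)$); and $I_{j+1}=\{i\in I_j:\theta_j^i>0\}\cup\{j\}$. *)

theory Defs
  imports "HOL-Analysis.Analysis"
begin

section \<open>Extended-real-valued convex functions\<close>

text \<open>Functions into \<open>\<real> \<union> {+\<infinity>}\<close> are functions into \<^typ>\<open>ereal\<close> that satisfy \<open>proper\<close>.
  The convention \<open>0 \<cdot> \<infinity> = 0\<close> of \<^typ>\<open>ereal\<close> is the one of convex analysis.\<close>

definition edom :: "('a \<Rightarrow> ereal) \<Rightarrow> 'a set" where
  "edom g = {x. g x < \<infinity>}"

definition proper :: "('a \<Rightarrow> ereal) \<Rightarrow> bool" where
  "proper g \<longleftrightarrow> (\<forall>x. g x \<noteq> - \<infinity>) \<and> edom g \<noteq> {}"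

definition lsc :: "('a::topological_space \<Rightarrow> ereal) \<Rightarrow> bool" where
  "lsc g \<longleftrightarrow> (\<forall>x. g x \<le> Liminf (at x) g)"

definition econvex :: "('a::real_vector \<Rightarrow> ereal) \<Rightarrow> bool" where
  "econvex g \<longleftrightarrow>
     (\<forall>x y. \<forall>u\<ge>0. \<forall>v\<ge>0. u + v = 1 \<longrightarrow>
        g (u *\<^sub>R x + v *\<^sub>R y) \<le> ereal u * g x + ereal v * g y)"

definition proper_lsc_convex :: "('a::euclidean_space \<Rightarrow> ereal) \<Rightarrow> bool" where
  "proper_lsc_convex g \<longleftrightarrow> proper g \<and> lsc g \<and> econvex g"

definition subdiff :: "('a::euclidean_space \<Rightarrow> ereal) \<Rightarrow> 'a \<Rightarrow> 'a set" where
  "subdiff g x = {v. \<forall>u. g u \<ge> g x + ereal (v \<bullet> (u - x))}"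

definition conjugate :: "('a::euclidean_space \<Rightarrow> ereal) \<Rightarrow> 'a \<Rightarrow> ereal" where
  "conjugate g z = (SUP x. ereal (z \<bullet> x) - g x)"

definition minimizers :: "('a \<Rightarrow> ereal) \<Rightarrow> 'a set" where
  "minimizers g = {x. is_arg_min g (\<lambda>_. True) x}"


section \<open>The composite problem and its prox-regularisation\<close>

definition phi :: "('a \<Rightarrow> ereal) \<Rightarrow> ('a \<Rightarrow> ereal) \<Rightarrow> 'a \<Rightarrow> ereal" where
  "phi f h u = f u + h u"

text \<open>Real-valued: it is only used at points \<open>y \<in> edom h \<subseteq> edom f\<close>, where \<open>f y\<close> is finite.\<close>

definition ell :: "('a::euclidean_space \<Rightarrow> ereal) \<Rightarrow> ('a \<Rightarrow> 'a) \<Rightarrow> 'a \<Rightarrow> 'a \<Rightarrow> real" where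
  "ell f f' y u = real_of_ereal (f y) + f' y \<bullet> (u - y)"

definition hlam :: "('a::euclidean_space \<Rightarrow> ereal) \<Rightarrow> real \<Rightarrow> 'a \<Rightarrow> 'a \<Rightarrow> ereal" where
  "hlam h lam x0 u = h u + ereal (1 / (2 * lam) * (norm (u - x0))\<^sup>2)"

definition philam ::
  "('a::euclidean_space \<Rightarrow> ereal) \<Rightarrow> ('a \<Rightarrow> ereal) \<Rightarrow> real \<Rightarrow> 'a \<Rightarrow> 'a \<Rightarrow> ereal" where
  "philam f h lam x0 u = f u + hlam h lam x0 u"

definition psi ::
  "('a::euclidean_space \<Rightarrow> ereal) \<Rightarrow> ('a \<Rightarrow> ereal) \<Rightarrow> real \<Rightarrow> 'a \<Rightarrow> 'a \<Rightarrow> ereal" where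
  "psi f h lam x0 z = conjugate (hlam h lam x0) (- z) + conjugate f z"

text \<open>The distance \<open>min {norm (x - y) | x \<in> minimizers (phi f h)}\<close> is rendered by \<^const>\<open>infdist\<close>;
  the minimum is attained.\<close>

lemma ereal_less_add_split:
  fixes y p q :: ereal
  assumes "y < p + q" "p \<noteq> - \<infinity>" "q \<noteq> - \<infinity>"
  obtains a b :: real where "ereal a < p" "ereal b < q" "y < ereal (a + b)"
proof -
  obtain r where r: "y < ereal r" "ereal r < p + q"
    using ereal_dense2[OF assms(1)] by blast
  have "ereal r - q < p"
    using r(2) assms(2,3) by (cases p; cases q) auto
  then obtain a where a: "ereal r - q < ereal a" "ereal a < p"
    using ereal_dense2 by blast
  have "ereal (r - a) < q"
    using a(1) assms(3) by (cases q) auto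
  moreover have "y < ereal (a + (r - a))"
    using r by simp
  ultimately show thesis using that[OF a(2)] by blast
qed

lemma lsc_add:
  assumes "lsc f" "lsc h" "\<And>x. f x \<noteq> - \<infinity>" "\<And>x. h x \<noteq> - \<infinity>"
  shows "lsc (\<lambda>x. f x + h x)"
  unfolding lsc_def le_Liminf_iff
proof (intro allI impI)
  fix x y assume "y < f x + h x"
  then obtain a b where ab: "ereal a < f x" "ereal b < h x" "y < ereal (a + b)"
    using ereal_less_add_split assms(3,4) by blast
  have "eventually (\<lambda>u. ereal a < f u) (at x)" "eventually (\<lambda>u. ereal b < h u) (at x)"
    using assms(1,2) ab(1,2) unfolding lsc_def le_Liminf_iff by blast+
  then show "eventually (\<lambda>u. y < f u + h u) (at x)"
  proof eventually_elim
    case (elim u)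
    then show ?case
      using ab(3) ereal_add_strict_mono2[of "ereal a" "f u" "ereal b" "h u"] by simp
  qed
qed

lemma closed_minimizers:
  fixes g :: "'a::euclidean_space \<Rightarrow> ereal"
  assumes "lsc g"
  shows "closed (minimizers g)"
proof -
  have "open (- minimizers g)"
  proof (subst open_subopen, intro ballI)
    fix x assume "x \<in> - minimizers g"
    then obtain y where "g y < g x" by (auto simp: minimizers_def is_arg_min_def)
    then have "eventually (\<lambda>u. g y < g u) (at x)"
      using assms unfolding lsc_def le_Liminf_iff by blast
    then have "eventually (\<lambda>u. g y < g u) (nhds x)"
      using \<open>g y < g x\<close> by (simp only: eventually_nhds_conv_at)
    then show "\<exists>T. open T \<and> x \<in> T \<and> T \<subseteq> - minimizers g"
      unfolding eventually_nhds by (auto simp: minimizers_def is_arg_min_def)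
  qed
  then show ?thesis by (simp add: closed_def)
qed

lemma infdist_minimizers_attained:
  assumes "proper_lsc_convex f" "proper_lsc_convex h" "minimizers (phi f h) \<noteq> {}"
  obtains x where "x \<in> minimizers (phi f h)" "infdist y (minimizers (phi f h)) = norm (x - y)"
proof -
  have "lsc (phi f h)"
    using lsc_add[of f h] assms(1,2) by (simp add: proper_lsc_convex_def proper_def phi_def[abs_def])
  then have "closed (minimizers (phi f h))"
    by (rule closed_minimizers)
  from infdist_attains_inf[OF this assms(3)]
  obtain x where "x \<in> minimizers (phi f h)" "infdist y (minimizers (phi f h)) = dist y x"
    by blast
  then show thesis
    by (intro that[of x]) (simp_all only: dist_norm norm_minus_commute[of y x])
qed


section \<open>PDCP and PDPB\<close>

text \<open>\<open>pdcp f f' h lam x0 eps xr xtr sr\<close>: some run of the (nondeterministic) method PDCP with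
  prox center \<open>x0\<close> stops and returns \<open>(xr, xtr, sr)\<close>; \<open>J\<close> is the iteration at which it stops.
  The minimizer of \<open>\<Gamma> j + hlam\<close> (and of \<open>\<Gamma>bar + hlam\<close>) is unique, these functions being strongly
  convex.\<close>

definition pdcp ::
  "('a::euclidean_space \<Rightarrow> ereal) \<Rightarrow> ('a \<Rightarrow> 'a) \<Rightarrow> ('a \<Rightarrow> ereal) \<Rightarrow> real \<Rightarrow> 'a \<Rightarrow> real \<Rightarrow>
   'a \<Rightarrow> 'a \<Rightarrow> 'a \<Rightarrow> bool" where
  "pdcp f f' h lam x0 eps xr xtr sr \<longleftrightarrow>
     (\<exists>(J::nat) (\<Gamma> :: nat \<Rightarrow> 'a \<Rightarrow> ereal) x xt s (\<tau> :: nat \<Rightarrow> real) (m :: nat \<Rightarrow> ereal) (t :: nat \<Rightarrow> ereal).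
        1 \<le> J \<and>
        \<Gamma> 1 = (\<lambda>u. ereal (ell f f' x0 u)) \<and>
        (\<forall>j\<in>{1..J}.
           x j \<in> minimizers (\<lambda>u. \<Gamma> j u + hlam h lam x0 u) \<and>
           m j = \<Gamma> j (x j) + hlam h lam x0 (x j) \<and>
           s j \<in> subdiff (\<Gamma> j) (x j) \<inter> uminus ` subdiff (hlam h lam x0) (x j) \<and>
           t j = philam f h lam x0 (xt j) - m j) \<and>
        xt 1 = x 1 \<and>
        (\<forall>j\<in>{2..J}.
           philam f h lam x0 (xt j) \<le>
             ereal (\<tau> (j - 1)) * philam f h lam x0 (xt (j - 1))
             + ereal (1 - \<tau> (j - 1)) * philam f h lam x0 (x j)) \<and>
        (\<forall>j\<in>{1..<J}.
           0 \<le> \<tau> j \<and> \<tau> j \<le> 1 \<and>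
           proper_lsc_convex (\<Gamma> (j + 1)) \<and> (\<forall>u. \<Gamma> (j + 1) u \<le> f u) \<and>
           (\<exists>\<Gamma>bar. proper_lsc_convex \<Gamma>bar \<and> (\<forall>u. \<Gamma>bar u \<le> f u) \<and>
              \<Gamma>bar (x j) = \<Gamma> j (x j) \<and>
              x j \<in> minimizers (\<lambda>u. \<Gamma>bar u + hlam h lam x0 u) \<and>
              (\<forall>u. \<Gamma> (j + 1) u \<ge>
                 ereal (\<tau> j) * \<Gamma>bar u + ereal (1 - \<tau> j) * ereal (ell f f' (x j) u)))) \<and>
        (\<forall>j\<in>{1..<J}. \<not> t j \<le> ereal eps) \<and> t J \<le> ereal eps \<and>
        xr = x J \<and> xtr = xt J \<and> sr = s J)"

text \<open>\<open>pdpb f f' h lam eps xh0 n xh xt s\<close>: \<open>xh 0, \<dots>, xh n\<close>, \<open>xt 1, \<dots>, xt n\<close>,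
  \<open>s 1, \<dots>, s n\<close> are produced by the first \<open>n\<close> cycles of PDPB started at \<open>xh0\<close>; the prox center
  of cycle \<open>n + 1\<close> is then \<open>xh n\<close>.\<close>

definition pdpb ::
  "('a::euclidean_space \<Rightarrow> ereal) \<Rightarrow> ('a \<Rightarrow> 'a) \<Rightarrow> ('a \<Rightarrow> ereal) \<Rightarrow> real \<Rightarrow> real \<Rightarrow> 'a \<Rightarrow>
   nat \<Rightarrow> (nat \<Rightarrow> 'a) \<Rightarrow> (nat \<Rightarrow> 'a) \<Rightarrow> (nat \<Rightarrow> 'a) \<Rightarrow> bool" where
  "pdpb f f' h lam eps xh0 n xh xt s \<longleftrightarrow>
     xh 0 = xh0 \<and>
     (\<forall>i\<in>{1..n}. pdcp f f' h lam (xh (i - 1)) eps (xh i) (xt i) (s i))"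


section \<open>The two CG variants\<close>

text \<open>Lagrange multipliers at an optimal solution \<open>p\<close> of \<open>min {F q | G i q \<le> 0 for i \<in> I}\<close> for finite
  \<open>I\<close>: dual feasibility, complementary slackness, and \<open>p\<close> minimizes the Lagrangian.\<close>

definition lagrange_multipliers ::
  "('p \<Rightarrow> ereal) \<Rightarrow> 'i set \<Rightarrow> ('i \<Rightarrow> 'p \<Rightarrow> real) \<Rightarrow> 'p \<Rightarrow> ('i \<Rightarrow> real) \<Rightarrow> bool" where
  "lagrange_multipliers F I G p \<mu> \<longleftrightarrow>
     (\<forall>i\<in>I. 0 \<le> \<mu> i \<and> \<mu> i * G i p = 0) \<and>
     p \<in> minimizers (\<lambda>q. F q + ereal (\<Sum>i\<in>I. \<mu> i * G i q))"

text \<open>The problem \<open>min {r + hlam u | c i u \<le> r for i \<in> I}\<close> over \<open>(u, r)\<close> for a family of cuts \<open>c\<close>.\<close>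

definition cut_objective ::
  "('a::euclidean_space \<Rightarrow> ereal) \<Rightarrow> real \<Rightarrow> 'a \<Rightarrow> 'a \<times> real \<Rightarrow> ereal" where
  "cut_objective h lam x0 = (\<lambda>(u, r). ereal r + hlam h lam x0 u)"

definition cut_solution ::
  "('a::euclidean_space \<Rightarrow> ereal) \<Rightarrow> real \<Rightarrow> 'a \<Rightarrow> 'i set \<Rightarrow> ('i \<Rightarrow> 'a \<Rightarrow> real) \<Rightarrow> 'a \<times> real \<Rightarrow> bool" where
  "cut_solution h lam x0 I c p \<longleftrightarrow>
     is_arg_min (cut_objective h lam x0) (\<lambda>(u, r). \<forall>i\<in>I. c i u \<le> r) p"

definition cut_multipliers ::
  "('a::euclidean_space \<Rightarrow> ereal) \<Rightarrow> real \<Rightarrow> 'a \<Rightarrow> 'i set \<Rightarrow> ('i \<Rightarrow> 'a \<Rightarrow> real) \<Rightarrow> 'a \<times> real \<Rightarrow>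
   ('i \<Rightarrow> real) \<Rightarrow> bool" where
  "cut_multipliers h lam x0 I c p \<mu> \<longleftrightarrow>
     lagrange_multipliers (cut_objective h lam x0) I (\<lambda>i (u, r). c i u - r) p \<mu>"

text \<open>In the two-cuts problem the index \<^term>\<open>True\<close> stands for the first constraint (aggregated
  cut) and \<^term>\<open>False\<close> for the second (newest cut).\<close>

definition two_cuts_cg ::
  "('a::euclidean_space \<Rightarrow> ereal) \<Rightarrow> ('a \<Rightarrow> 'a) \<Rightarrow> ('a \<Rightarrow> ereal) \<Rightarrow> real \<Rightarrow> 'a \<Rightarrow>
   (nat \<Rightarrow> 'a) \<Rightarrow> (nat \<Rightarrow> 'a) \<Rightarrow> bool" where
  "two_cuts_cg f f' h lam x0 x z \<longleftrightarrow>
     (\<exists>(\<Gamma> :: nat \<Rightarrow> 'a \<Rightarrow> real) (\<Gamma>bar :: nat \<Rightarrow> 'a \<Rightarrow> real) (\<theta> :: nat \<Rightarrow> real).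
        x 0 = x0 \<and>
        \<Gamma>bar 0 = ell f f' x0 \<and>
        (\<forall>j\<ge>1. let c = (\<lambda>b. if b then \<Gamma>bar (j - 1) else ell f f' (x (j - 1))) in
           \<Gamma> j = (\<lambda>u. max (\<Gamma>bar (j - 1) u) (ell f f' (x (j - 1)) u)) \<and>
           cut_solution h lam x0 (UNIV :: bool set) c (x j, \<Gamma> j (x j)) \<and>
           0 \<le> \<theta> (j - 1) \<and> \<theta> (j - 1) \<le> 1 \<and>
           cut_multipliers h lam x0 (UNIV :: bool set) c (x j, \<Gamma> j (x j))
             (\<lambda>b. if b then \<theta> (j - 1) else 1 - \<theta> (j - 1)) \<and>
           \<Gamma>bar j = (\<lambda>u. \<theta> (j - 1) * \<Gamma>bar (j - 1) u
                        + (1 - \<theta> (j - 1)) * ell f f' (x (j - 1)) u) \<and>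
           (\<forall>u. GDERIV (\<Gamma>bar j) u :> z j)))"

definition multi_cuts_cg ::
  "('a::euclidean_space \<Rightarrow> ereal) \<Rightarrow> ('a \<Rightarrow> 'a) \<Rightarrow> ('a \<Rightarrow> ereal) \<Rightarrow> real \<Rightarrow> 'a \<Rightarrow>
   (nat \<Rightarrow> 'a) \<Rightarrow> (nat \<Rightarrow> 'a) \<Rightarrow> bool" where
  "multi_cuts_cg f f' h lam x0 x z \<longleftrightarrow>
     (\<exists>(\<Gamma> :: nat \<Rightarrow> 'a \<Rightarrow> real) (I :: nat \<Rightarrow> nat set) (\<theta> :: nat \<Rightarrow> nat \<Rightarrow> real) (zbar :: nat \<Rightarrow> 'a).
        x 0 = x0 \<and>
        I 1 = {0} \<and> zbar 0 = f' x0 \<and> z 1 = f' x0 \<and>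
        (\<forall>j\<ge>1. let c = (\<lambda>i. ell f f' (x i)) in
           \<Gamma> j = (\<lambda>u. Max ((\<lambda>i. c i u) ` I j)) \<and>
           cut_solution h lam x0 (I j) c (x j, \<Gamma> j (x j)) \<and>
           (\<Sum>i\<in>I j. \<theta> j i) = 1 \<and>
           cut_multipliers h lam x0 (I j) c (x j, \<Gamma> j (x j)) (\<theta> j) \<and>
           z j = (\<Sum>i\<in>I j. \<theta> j i *\<^sub>R zbar i) \<and>
           zbar j = f' (x j) \<and>
           I (j + 1) = {i \<in> I j. \<theta> j i > 0} \<union> {j}))"

end

theory Submission
  imports Defs
begin

text \<open>
  The two variants differ in how they manage their cuts, but they share one structure: there is an
  affine minorant \<open>A\<^sub>j\<close> of \<open>f\<close> with gradient \<open>z\<^sub>j\<close>, a convex combination of subgradient cuts, such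
  that \<open>x\<^sub>j\<close> minimizes \<open>A\<^sub>j + h\<^sup>\<lambda>\<close>. The combination is formed with the Lagrange multipliers of the
  cutting-plane problem, and complementary slackness makes \<open>A\<^sub>j\<close> agree with the full model at
  \<open>x\<^sub>j\<close>. Since the model of the next iteration keeps every active cut and adds the cut at \<open>x\<^sub>j\<close>, the
  next minorant dominates both \<open>A\<^sub>j\<close> and the cut at \<open>x\<^sub>j\<close> at the point \<open>x\<^sub>j\<^sub>+\<^sub>1\<close>. This common
  structure is \<open>aggregated_cuts\<close>; the lemmas \<open>two_cuts_aggregated\<close> and \<open>multi_cuts_aggregated\<close>
  establish it.

  Let \<open>m\<^sub>j\<close> be the minimum of \<open>A\<^sub>j + h\<^sup>\<lambda>\<close>. By Fenchel duality \<open>\<psi>(z\<^sub>j) \<le> - m\<^sub>j\<close>, so the primal-dual gap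
  is at most \<open>t\<^sub>j = \<phi>\<^sup>\<lambda>(xt\<^sub>j) - m\<^sub>j\<close>. The function \<open>A\<^sub>j + h\<^sup>\<lambda>\<close> is \<open>1/\<lambda>\<close>-strongly convex and a cut
  misses \<open>f\<close> at distance \<open>d\<close> by at most \<open>2Md\<close>; hence, with \<open>\<tau> = j/(j+2)\<close> and
  \<open>d = \<parallel>x\<^sub>j\<^sub>+\<^sub>1 - x\<^sub>j\<parallel>\<close>, \<open>t\<^sub>j\<^sub>+\<^sub>1 \<le> \<tau> t\<^sub>j + 2(1-\<tau>)Md - \<tau>d\<^sup>2/(2\<lambda>)\<close>. Maximizing over \<open>d\<close> gives
  \<open>(j+1)(j+2) t\<^sub>j\<^sub>+\<^sub>1 \<le> j(j+1) t\<^sub>j + 16\<lambda>M\<^sup>2\<close>, which telescopes (\<open>aggregated_cuts_gap\<close>).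

  What remains is \<open>t\<^sub>1 \<le> 2M\<parallel>x\<^sub>1 - x\<^sub>0\<parallel>\<close>. Comparing the first prox step with a minimizer \<open>w\<close> of \<open>\<phi>\<close>
  yields \<open>\<parallel>x\<^sub>1 - x\<^sub>0\<parallel> \<le> \<parallel>w - x\<^sub>0\<parallel> + 2\<lambda>M\<close> (\<open>first_step_length\<close>). Each PDCP cycle increases the squared
  distance to \<open>w\<close> by at most \<open>2\<lambda>\<epsilon>\<close> (\<open>pdcp_step\<close>), so the bound on \<open>k\<close> gives
  \<open>\<parallel>w - x\<^sub>0\<parallel>\<^sup>2 \<le> d\<^sub>0\<^sup>2 + 4 d\<^sub>0\<^sup>2 \<le> (6 d\<^sub>0)\<^sup>2\<close> when \<open>w\<close> is the minimizer nearest to the starting point.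
\<close>

section \<open>Minimizers of quadratically regularized convex functions\<close>

lemma econvex_add:
  assumes "econvex g" "econvex k" "\<And>x. g x \<noteq> - \<infinity>" "\<And>x. k x \<noteq> - \<infinity>"
  shows "econvex (\<lambda>x. g x + k x)"
  unfolding econvex_def
proof (intro allI impI)
  fix x y :: 'a and u v :: real
  assume uv: "0 \<le> u" "0 \<le> v" "u + v = 1"
  have "g (u *\<^sub>R x + v *\<^sub>R y) + k (u *\<^sub>R x + v *\<^sub>R y)
      \<le> (ereal u * g x + ereal v * g y) + (ereal u * k x + ereal v * k y)"
    using assms(1,2) uv unfolding econvex_def by (intro add_mono) blast+
  also have "\<dots> = (ereal u * g x + ereal u * k x) + (ereal v * g y + ereal v * k y)"
    by (simp add: ac_simps)
  also have "\<dots> = ereal u * (g x + k x) + ereal v * (g y + k y)"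
    by (simp add: ereal_distrib_left ereal_right_distrib assms(3,4) uv)
  finally show "g (u *\<^sub>R x + v *\<^sub>R y) + k (u *\<^sub>R x + v *\<^sub>R y)
      \<le> ereal u * (g x + k x) + ereal v * (g y + k y)" .
qed

lemma econvex_affine:
  fixes w :: "'a::euclidean_space"
  shows "econvex (\<lambda>u. ereal (b + w \<bullet> u))"
  unfolding econvex_def
proof (intro allI impI)
  fix x y :: 'a and u v :: real
  assume "0 \<le> u" "0 \<le> v" "u + v = 1"
  then have "b = u * b + v * b"
    by (simp flip: distrib_right)
  then show "ereal (b + w \<bullet> (u *\<^sub>R x + v *\<^sub>R y))
      \<le> ereal u * ereal (b + w \<bullet> x) + ereal v * ereal (b + w \<bullet> y)"
    by (simp add: inner_add_right algebra_simps)
qed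

lemma minimizersD: "x \<in> minimizers g \<Longrightarrow> g x \<le> g u"
  by (auto simp: minimizers_def is_arg_min_def not_less)

lemma norm_sq_segment:
  fixes x u p :: "'a::euclidean_space"
  shows "(norm ((1 - t) *\<^sub>R x + t *\<^sub>R u - p))\<^sup>2
    = (1 - t) * (norm (x - p))\<^sup>2 + t * (norm (u - p))\<^sup>2 - t * (1 - t) * (norm (u - x))\<^sup>2"
  by (simp add: power2_norm_eq_inner inner_simps inner_commute algebra_simps)

text \<open>On the segment from \<open>x\<close> to \<open>u\<close> the regularized function lies below its chord by
  \<open>c t (1 - t) \<parallel>u - x\<parallel>\<^sup>2\<close>. Comparing the value at parameter \<open>t\<close> with the minimum, dividing by \<open>t\<close> and
  letting \<open>t\<close> tend to \<open>0\<close> leaves the quadratic growth term.\<close>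

lemma prox_minimizer_growth:
  fixes G :: "'a::euclidean_space \<Rightarrow> ereal" and c :: real
  assumes conv: "econvex G" and ninf: "\<And>u. G u \<noteq> - \<infinity>" and fin: "G x < \<infinity>"
    and min: "x \<in> minimizers (\<lambda>u. G u + ereal (c * (norm (u - p))\<^sup>2))"
  shows "G x + ereal (c * (norm (x - p))\<^sup>2 + c * (norm (u - x))\<^sup>2)
      \<le> G u + ereal (c * (norm (u - p))\<^sup>2)"
proof (cases "G u")
  case (real b)
  obtain a where a: "G x = ereal a"
    using fin ninf[of x] by (cases "G x") auto
  \<comment> \<open>\<open>s\<close> is \<open>1 - t\<close>; the limit \<open>t \<rightarrow> 0\<close> is taken as the supremum over \<open>s < 1\<close>.\<close>
  have "s * (c * (norm (u - x))\<^sup>2) \<le> b + c * (norm (u - p))\<^sup>2 - (a + c * (norm (x - p))\<^sup>2)"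
    if s: "0 < s" "s < 1" for s
  proof -
    define t where "t = 1 - s"
    have t: "0 < t" "t < 1" using s by (auto simp: t_def)
    define y where "y = (1 - t) *\<^sub>R x + t *\<^sub>R u"
    have "G y \<le> ereal (1 - t) * G x + ereal t * G u"
      using conv t unfolding econvex_def y_def by auto
    then have Gy: "G y \<le> ereal ((1 - t) * a + t * b)"
      by (simp add: a real)
    have "ereal (a + c * (norm (x - p))\<^sup>2) \<le> G y + ereal (c * (norm (y - p))\<^sup>2)"
      using minimizersD[OF min, of y] by (simp add: a)
    also have "\<dots> \<le> ereal ((1 - t) * a + t * b) + ereal (c * (norm (y - p))\<^sup>2)"
      by (intro add_mono Gy order_refl)
    finally have "a + c * (norm (x - p))\<^sup>2 \<le> (1 - t) * a + t * b + c * (norm (y - p))\<^sup>2"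
      by simp
    then have "t * (a + c * (norm (x - p))\<^sup>2 + s * (c * (norm (u - x))\<^sup>2))
        \<le> t * (b + c * (norm (u - p))\<^sup>2)"
      unfolding y_def norm_sq_segment by (simp add: t_def algebra_simps)
    with t have "a + c * (norm (x - p))\<^sup>2 + s * (c * (norm (u - x))\<^sup>2) \<le> b + c * (norm (u - p))\<^sup>2"
      by simp
    then show ?thesis by simp
  qed
  then have "c * (norm (u - x))\<^sup>2 \<le> b + c * (norm (u - p))\<^sup>2 - (a + c * (norm (x - p))\<^sup>2)"
    by (rule field_le_mult_one_interval)
  then show ?thesis by (simp add: a real)
qed (use ninf[of u] in auto)

section \<open>Aggregation of cuts by Lagrange multipliers\<close>

text \<open>When the multipliers sum to one, the epigraph variable cancels from the Lagrangian, and what is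
  left is the aggregated cut plus \<open>h\<^sup>\<lambda>\<close>, minimized by the same point. Complementary slackness says
  that the aggregate loses nothing at that point.\<close>

lemma cut_multipliers_aggregate:
  assumes mult: "cut_multipliers h lam x0 I c (x, r) \<mu>" and sum1: "(\<Sum>i\<in>I. \<mu> i) = 1"
  shows "x \<in> minimizers (\<lambda>u. ereal (\<Sum>i\<in>I. \<mu> i * c i u) + hlam h lam x0 u)"
    and "(\<Sum>i\<in>I. \<mu> i * c i x) = r"
    and "\<And>i. i \<in> I \<Longrightarrow> 0 \<le> \<mu> i"
proof -
  have slack: "0 \<le> \<mu> i" "\<mu> i * c i x = \<mu> i * r" if "i \<in> I" for i
    using mult that by (auto simp: cut_multipliers_def lagrange_multipliers_def algebra_simps)
  show "\<And>i. i \<in> I \<Longrightarrow> 0 \<le> \<mu> i"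
    by (rule slack)
  have "(\<Sum>i\<in>I. \<mu> i * c i x) = (\<Sum>i\<in>I. \<mu> i * r)"
    by (intro sum.cong refl slack(2))
  also have "\<dots> = r"
    by (simp add: sum1 flip: sum_distrib_right)
  finally show "(\<Sum>i\<in>I. \<mu> i * c i x) = r" .
  have L: "cut_objective h lam x0 (u, q) + ereal (\<Sum>i\<in>I. \<mu> i * (c i u - q))
      = ereal (\<Sum>i\<in>I. \<mu> i * c i u) + hlam h lam x0 u" for u q
  proof -
    have "(\<Sum>i\<in>I. \<mu> i * (c i u - q)) = (\<Sum>i\<in>I. \<mu> i * c i u) - q"
      by (simp add: right_diff_distrib sum_subtractf sum1 flip: sum_distrib_right)
    then show ?thesis
      by (cases "hlam h lam x0 u") (auto simp: cut_objective_def)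
  qed
  have "(x, r) \<in> minimizers
      (\<lambda>q. cut_objective h lam x0 q + ereal (\<Sum>i\<in>I. \<mu> i * (case q of (u, r) \<Rightarrow> c i u - r)))"
    using mult by (simp add: cut_multipliers_def lagrange_multipliers_def case_prod_unfold)
  from minimizersD[OF this, of "(u, 0)" for u]
  show "x \<in> minimizers (\<lambda>u. ereal (\<Sum>i\<in>I. \<mu> i * c i u) + hlam h lam x0 u)"
    by (simp add: L[where q = 0, simplified] L minimizers_def is_arg_min_def not_less)
qed

section \<open>Composite functions with bounded subgradients\<close>

lemma ell_affine: "ell f f' y u = ell f f' y 0 + f' y \<bullet> u"
  by (simp add: ell_def inner_diff_right)

locale lipschitz_composite =
  fixes f h :: "'a::euclidean_space \<Rightarrow> ereal" and f' :: "'a \<Rightarrow> 'a" and M lam :: real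
  assumes f: "proper_lsc_convex f" and h: "proper_lsc_convex h"
    and dom: "edom h \<subseteq> edom f"
    and subgrad: "\<And>y. y \<in> edom h \<Longrightarrow> f' y \<in> subdiff f y"
    and bounded: "\<And>y. y \<in> edom h \<Longrightarrow> norm (f' y) \<le> M"
    and M_pos: "M > 0" and lam: "lam > 0"
begin

lemma f_ninf [simp]: "f u \<noteq> - \<infinity>" and h_ninf [simp]: "h u \<noteq> - \<infinity>"
  using f h by (auto simp: proper_lsc_convex_def proper_def)

lemma f_eq: "y \<in> edom h \<Longrightarrow> f y = ereal (real_of_ereal (f y))"
  using dom f_ninf[of y] by (cases "f y") (auto simp: edom_def)

lemma h_eq: "y \<in> edom h \<Longrightarrow> h y = ereal (real_of_ereal (h y))"
  using h_ninf[of y] by (cases "h y") (auto simp: edom_def)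

lemma ell_minorant:
  assumes "y \<in> edom h"
  shows "ereal (ell f f' y u) \<le> f u"
proof -
  have "f y + ereal (f' y \<bullet> (u - y)) \<le> f u"
    using subgrad[OF assms] by (simp add: subdiff_def)
  then show ?thesis
    by (subst (asm) f_eq[OF assms]) (simp add: ell_def)
qed

text \<open>The cut at \<open>y\<close> bounds \<open>f x\<close> from below, so the error of the cut at \<open>x\<close> is at most
  \<open>(f' y - f' x) \<bullet> (y - x)\<close>, and subgradients differ by at most \<open>2M\<close>.\<close>

lemma ell_error:
  assumes x: "x \<in> edom h" and y: "y \<in> edom h"
  shows "real_of_ereal (f y) \<le> ell f f' x y + 2 * M * norm (y - x)"
proof -
  have "ereal (ell f f' y x) \<le> ereal (real_of_ereal (f x))"
    using ell_minorant[OF y, of x] f_eq[OF x] by simp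
  then have "real_of_ereal (f y) + f' y \<bullet> (x - y) \<le> real_of_ereal (f x)"
    by (simp add: ell_def)
  then have "real_of_ereal (f y) \<le> ell f f' x y + (f' y - f' x) \<bullet> (y - x)"
    by (simp add: ell_def inner_simps)
  also have "(f' y - f' x) \<bullet> (y - x) \<le> norm (f' y - f' x) * norm (y - x)"
    by (rule norm_cauchy_schwarz)
  also have "\<dots> \<le> (2 * M) * norm (y - x)"
    using norm_triangle_ineq4[of "f' y" "f' x"] bounded[OF x] bounded[OF y]
    by (intro mult_right_mono) auto
  finally show ?thesis by simp
qed

lemma minimizer_in_edom:
  assumes min: "x \<in> minimizers (\<lambda>u. G u + hlam h lam p u)"
    and w: "w \<in> edom h" "G w < \<infinity>" and ninf: "\<And>u. G u \<noteq> - \<infinity>"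
  shows "x \<in> edom h" "G x < \<infinity>"
proof -
  have "G w + hlam h lam p w < \<infinity>"
    using w by (auto simp: hlam_def edom_def)
  with minimizersD[OF min, of w] have "G x + hlam h lam p x < \<infinity>"
    by (rule le_less_trans)
  then show "x \<in> edom h" "G x < \<infinity>"
    using ninf[of x] by (auto simp: hlam_def edom_def)
qed

lemma model_growth:
  assumes conv: "econvex G" and ninf: "\<And>u. G u \<noteq> - \<infinity>"
    and x: "x \<in> edom h" "G x < \<infinity>"
    and min: "x \<in> minimizers (\<lambda>u. G u + hlam h lam p u)"
  shows "G x + hlam h lam p x + ereal (1 / (2 * lam) * (norm (u - x))\<^sup>2) \<le> G u + hlam h lam p u"
proof -
  have "econvex (\<lambda>u. G u + h u)"
    using conv h ninf by (intro econvex_add) (auto simp: proper_lsc_convex_def)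
  moreover have "x \<in> minimizers (\<lambda>u. (G u + h u) + ereal (1 / (2 * lam) * (norm (u - p))\<^sup>2))"
    using min by (simp add: hlam_def add.assoc)
  ultimately have "(G x + h x) + ereal (1 / (2 * lam) * (norm (x - p))\<^sup>2
        + 1 / (2 * lam) * (norm (u - x))\<^sup>2)
      \<le> (G u + h u) + ereal (1 / (2 * lam) * (norm (u - p))\<^sup>2)"
    using x ninf by (intro prox_minimizer_growth) (auto simp: edom_def)
  then show ?thesis
    by (simp only: hlam_def add.assoc plus_ereal.simps(1)[symmetric])
qed

lemma phi_minimizer_in_edom:
  assumes "w \<in> minimizers (phi f h)"
  shows "w \<in> edom h"
proof -
  obtain y where "y \<in> edom h"
    using h by (auto simp: proper_lsc_convex_def proper_def)
  then have "phi f h y < \<infinity>"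
    using dom by (auto simp: phi_def edom_def)
  with minimizersD[OF assms, of y] have "phi f h w < \<infinity>"
    by (rule le_less_trans)
  then show ?thesis by (auto simp: phi_def edom_def)
qed

section \<open>Drift of the prox centers\<close>

text \<open>Strong convexity compares the final model at \<open>w\<close> with its minimum value, which by the stopping
  rule lies within \<open>eps\<close> of some value of \<open>philam\<close>, hence is at least \<open>min \<phi> - eps\<close>. The model
  value at \<open>w\<close> is at most \<open>\<phi> w = min \<phi>\<close> plus the prox term, so \<open>min \<phi>\<close> cancels.\<close>

lemma pdcp_step:
  assumes run: "pdcp f f' h lam p eps xr xtr sr"
    and p: "p \<in> edom h" and w: "w \<in> minimizers (phi f h)"
  shows "xr \<in> edom h" "(norm (w - xr))\<^sup>2 \<le> (norm (w - p))\<^sup>2 + 2 * lam * eps"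
proof -
  have wd: "w \<in> edom h" using w by (rule phi_minimizer_in_edom)
  \<comment> \<open>\<open>G\<close> is the model at the stopping iteration. It is a convex minorant of \<open>f\<close>: at the first
    iteration because it is a subgradient cut, later by the requirement on the models.\<close>
  have "\<exists>G y. econvex G \<and> (\<forall>u. G u \<noteq> - \<infinity>) \<and> (\<forall>u. G u \<le> f u)
      \<and> xr \<in> minimizers (\<lambda>u. G u + hlam h lam p u)
      \<and> philam f h lam p y - (G xr + hlam h lam p xr) \<le> ereal eps"
    using run unfolding pdcp_def
  proof (elim exE conjE)
    fix J \<Gamma> x xt s \<tau> m t
    assume J: "1 \<le> (J::nat)" and G1: "\<Gamma> 1 = (\<lambda>u. ereal (ell f f' p u))"
      and it: "\<forall>j\<in>{1..J}. x j \<in> minimizers (\<lambda>u. \<Gamma> j u + hlam h lam p u) \<and>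
           m j = \<Gamma> j (x j) + hlam h lam p (x j) \<and>
           s j \<in> subdiff (\<Gamma> j) (x j) \<inter> uminus ` subdiff (hlam h lam p) (x j) \<and>
           t j = philam f h lam p (xt j) - m j"
      and up: "\<forall>j\<in>{1..<J}.
           0 \<le> \<tau> j \<and> \<tau> j \<le> 1 \<and>
           proper_lsc_convex (\<Gamma> (j + 1)) \<and> (\<forall>u. \<Gamma> (j + 1) u \<le> f u) \<and>
           (\<exists>\<Gamma>bar. proper_lsc_convex \<Gamma>bar \<and> (\<forall>u. \<Gamma>bar u \<le> f u) \<and>
              \<Gamma>bar (x j) = \<Gamma> j (x j) \<and>
              x j \<in> minimizers (\<lambda>u. \<Gamma>bar u + hlam h lam p u) \<and>
              (\<forall>u. \<Gamma> (j + 1) u \<ge>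
                 ereal (\<tau> j) * \<Gamma>bar u + ereal (1 - \<tau> j) * ereal (ell f f' (x j) u)))"
      and stop: "t J \<le> ereal eps" and xr: "xr = x J"
    have "econvex (\<Gamma> J) \<and> (\<forall>u. \<Gamma> J u \<noteq> - \<infinity>) \<and> (\<forall>u. \<Gamma> J u \<le> f u)"
    proof (cases "J = 1")
      case True
      have "econvex (\<lambda>u. ereal (ell f f' p u))"
        by (subst ell_affine) (rule econvex_affine)
      with True show ?thesis
        using ell_minorant[OF p] by (simp only: G1) simp
    next
      case False
      then have "J - 1 \<in> {1..<J}" "J - 1 + 1 = J" using J by auto
      then show ?thesis
        using up by (metis proper_lsc_convex_def proper_def)
    qed
    with it J stop xr show ?thesis
      by (intro exI[of _ "\<Gamma> J"] exI[of _ "xt J"]) auto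
  qed
  then obtain G y where G: "econvex G" "\<And>u. G u \<noteq> - \<infinity>" "\<And>u. G u \<le> f u"
    and min: "xr \<in> minimizers (\<lambda>u. G u + hlam h lam p u)"
    and gap: "philam f h lam p y - (G xr + hlam h lam p xr) \<le> ereal eps"
    by blast
  have Gw: "G w < \<infinity>"
    using G(3)[of w] wd dom by (auto simp: edom_def intro: le_less_trans)
  note xr = minimizer_in_edom[OF min wd Gw G(2)]
  show "xr \<in> edom h" by (rule xr)
  obtain g where g: "G xr = ereal g" using xr(2) G(2)[of xr] by (cases "G xr") auto
  define q where "q u = 1 / (2 * lam) * (norm (u - p))\<^sup>2" for u
  define V where "V = g + real_of_ereal (h xr) + q xr"
  have V: "G xr + hlam h lam p xr = ereal V"
    by (subst hlam_def, subst h_eq[OF xr(1)]) (simp add: g V_def q_def)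
  define Phi where "Phi = real_of_ereal (f w) + real_of_ereal (h w)"
  have Phi: "phi f h w = ereal Phi"
    by (subst phi_def, subst f_eq[OF wd], subst h_eq[OF wd]) (simp add: Phi_def)
  have "G u + hlam h lam p u \<le> phi f h u + ereal (q u)" for u
    unfolding hlam_def phi_def q_def by (simp add: add.assoc[symmetric] add_right_mono G(3))
  from order_trans[OF model_growth[OF G(1,2) xr min, of w] this]
  have 1: "V + 1 / (2 * lam) * (norm (w - xr))\<^sup>2 \<le> Phi + q w"
    by (simp add: V Phi)
  have "ereal Phi \<le> phi f h y"
    using minimizersD[OF w, of y] by (simp add: Phi)
  also have "\<dots> \<le> phi f h y + ereal (q y)"
    using lam by (cases "phi f h y") (auto simp: q_def)
  also have "\<dots> = philam f h lam p y"
    by (simp add: phi_def philam_def hlam_def q_def add.assoc)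
  also have "\<dots> \<le> ereal (V + eps)"
    using gap by (cases "philam f h lam p y") (auto simp: V)
  finally have "Phi \<le> V + eps" by simp
  with 1 have "1 / (2 * lam) * (norm (w - xr))\<^sup>2 \<le> 1 / (2 * lam) * (norm (w - p))\<^sup>2 + eps"
    by (simp add: q_def)
  with lam show "(norm (w - xr))\<^sup>2 \<le> (norm (w - p))\<^sup>2 + 2 * lam * eps"
    by (simp add: field_simps)
qed

lemma pdpb_centers:
  assumes run: "pdpb f f' h lam eps xh0 n xh xt s"
    and xh0: "xh0 \<in> edom h" and w: "w \<in> minimizers (phi f h)" and "i \<le> n"
  shows "xh i \<in> edom h \<and> (norm (w - xh i))\<^sup>2 \<le> (norm (w - xh0))\<^sup>2 + 2 * lam * eps * real i"
  using \<open>i \<le> n\<close>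
proof (induction i)
  case 0
  then show ?case using run xh0 by (simp add: pdpb_def)
next
  case (Suc i)
  then have IH: "xh i \<in> edom h"
    "(norm (w - xh i))\<^sup>2 \<le> (norm (w - xh0))\<^sup>2 + 2 * lam * eps * real i"
    by auto
  have "pdcp f f' h lam (xh i) eps (xh (Suc i)) (xt (Suc i)) (s (Suc i))"
    using run Suc.prems unfolding pdpb_def by (metis atLeastAtMost_iff diff_Suc_1 le_add1 plus_1_eq_Suc)
  from pdcp_step[OF this IH(1) w] IH(2) show ?case
    by (simp add: algebra_simps)
qed

section \<open>The common structure of the two variants\<close>

text \<open>The affine minorant of iteration \<open>j\<close> is \<open>\<lambda>u. b j + z j \<bullet> u\<close>. The last two conditions compare
  consecutive minorants only at the new iterate, since in general neither dominates the other
  elsewhere.\<close>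

definition aggregated_cuts :: "'a \<Rightarrow> (nat \<Rightarrow> 'a) \<Rightarrow> (nat \<Rightarrow> 'a) \<Rightarrow> (nat \<Rightarrow> real) \<Rightarrow> bool" where
  "aggregated_cuts p x z b \<longleftrightarrow>
     x 0 = p \<and> (\<forall>u. b 1 + z 1 \<bullet> u = ell f f' p u) \<and>
     (\<forall>j\<ge>1. (\<forall>u. ereal (b j + z j \<bullet> u) \<le> f u) \<and>
        x j \<in> minimizers (\<lambda>u. ereal (b j + z j \<bullet> u) + hlam h lam p u) \<and>
        b j + z j \<bullet> x (Suc j) \<le> b (Suc j) + z (Suc j) \<bullet> x (Suc j) \<and>
        ell f f' (x j) (x (Suc j)) \<le> b (Suc j) + z (Suc j) \<bullet> x (Suc j))"

lemma real_model_minimizer_in_edom: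
  assumes "x \<in> minimizers (\<lambda>u. ereal (g u) + hlam h lam p u)"
  shows "x \<in> edom h"
proof -
  obtain y where "y \<in> edom h"
    using h by (auto simp: proper_lsc_convex_def proper_def)
  from minimizer_in_edom(1)[OF assms this] show ?thesis by simp
qed

text \<open>The minorants are the functions \<open>\<Gamma>bar j\<close> of the method. The maximum of the two cuts is attained
  by \<open>\<Gamma>bar (j + 1)\<close> at \<open>x (j + 1)\<close> by complementary slackness, and since \<open>\<Gamma>bar j\<close> is affine, its
  gradient \<open>z j\<close> is its slope.\<close>

lemma two_cuts_aggregated:
  assumes cg: "two_cuts_cg f f' h lam p x z" and p: "p \<in> edom h"
  shows "\<exists>b. aggregated_cuts p x z b"
proof -
  obtain \<Gamma> \<Gamma>bar \<theta> where x0: "x 0 = p" and G0: "\<Gamma>bar 0 = ell f f' p"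
    and step: "\<forall>j\<ge>1. let c = (\<lambda>b. if b then \<Gamma>bar (j - 1) else ell f f' (x (j - 1))) in
           \<Gamma> j = (\<lambda>u. max (\<Gamma>bar (j - 1) u) (ell f f' (x (j - 1)) u)) \<and>
           cut_solution h lam p (UNIV :: bool set) c (x j, \<Gamma> j (x j)) \<and>
           0 \<le> \<theta> (j - 1) \<and> \<theta> (j - 1) \<le> 1 \<and>
           cut_multipliers h lam p (UNIV :: bool set) c (x j, \<Gamma> j (x j))
             (\<lambda>b. if b then \<theta> (j - 1) else 1 - \<theta> (j - 1)) \<and>
           \<Gamma>bar j = (\<lambda>u. \<theta> (j - 1) * \<Gamma>bar (j - 1) u
                        + (1 - \<theta> (j - 1)) * ell f f' (x (j - 1)) u) \<and>
           (\<forall>u. GDERIV (\<Gamma>bar j) u :> z j)"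
    using cg unfolding two_cuts_cg_def by (elim exE conjE) blast
  have one: "1 \<le> Suc i" for i by simp
  note cycle = step[rule_format, OF one, unfolded Let_def diff_Suc_1]
  have th: "0 \<le> \<theta> i" "\<theta> i \<le> 1" and der: "GDERIV (\<Gamma>bar (Suc i)) u :> z (Suc i)" for i u
    using cycle[of i] by blast+
  have Gs: "\<Gamma>bar (Suc i) u = \<theta> i * \<Gamma>bar i u + (1 - \<theta> i) * ell f f' (x i) u"
    and max: "\<Gamma> (Suc i) u = max (\<Gamma>bar i u) (ell f f' (x i) u)" for i u
    using cycle[of i] by metis+
  have mult: "cut_multipliers h lam p UNIV (\<lambda>b. if b then \<Gamma>bar i else ell f f' (x i))
      (x (Suc i), max (\<Gamma>bar i (x (Suc i))) (ell f f' (x i) (x (Suc i))))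
      (\<lambda>b. if b then \<theta> i else 1 - \<theta> i)" for i
    using cycle[of i] unfolding max by blast
  have min: "x (Suc i) \<in> minimizers (\<lambda>u. ereal (\<Gamma>bar (Suc i) u) + hlam h lam p u)"
    and val: "\<Gamma>bar (Suc i) (x (Suc i)) = max (\<Gamma>bar i (x (Suc i))) (ell f f' (x i) (x (Suc i)))" for i
    using cut_multipliers_aggregate(1,2)[OF mult[of i]] by (simp_all add: UNIV_bool Gs add.commute)
  have xd: "x i \<in> edom h" for i
    using real_model_minimizer_in_edom[OF min] p x0 by (cases i) auto
  have minor: "ereal (\<Gamma>bar i u) \<le> f u" for i u
  proof (induction i)
    case 0
    then show ?case using ell_minorant[OF p] by (simp add: G0)
  next
    case (Suc i)
    show ?case
    proof (cases "f u")
      case (real r)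
      then have "\<Gamma>bar i u \<le> r" "ell f f' (x i) u \<le> r"
        using Suc ell_minorant[OF xd[of i], of u] by auto
      then have "\<theta> i * \<Gamma>bar i u + (1 - \<theta> i) * ell f f' (x i) u \<le> r"
        by (intro convex_bound_le) (use th[of i] in auto)
      then show ?thesis by (simp add: Gs real)
    qed auto
  qed
  have aff: "\<exists>w. \<forall>u. \<Gamma>bar i u = \<Gamma>bar i 0 + w \<bullet> u" for i
  proof (induction i)
    case 0
    show ?case unfolding G0 using ell_affine by blast
  next
    case (Suc i)
    then obtain w where w: "\<And>u. \<Gamma>bar i u = \<Gamma>bar i 0 + w \<bullet> u" by blast
    have "\<Gamma>bar (Suc i) u = \<Gamma>bar (Suc i) 0 + (\<theta> i *\<^sub>R w + (1 - \<theta> i) *\<^sub>R f' (x i)) \<bullet> u" for u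
      unfolding Gs by (subst w, subst ell_affine) (simp add: inner_add_left algebra_simps)
    then show ?case by blast
  qed
  have affz: "\<Gamma>bar (Suc i) u = \<Gamma>bar (Suc i) 0 + z (Suc i) \<bullet> u" for i u
  proof -
    obtain w where w: "\<And>u. \<Gamma>bar (Suc i) u = \<Gamma>bar (Suc i) 0 + w \<bullet> u" using aff by blast
    have "\<Gamma>bar (Suc i) = (\<lambda>u. \<Gamma>bar (Suc i) 0 + w \<bullet> u)" using w by blast
    moreover have "GDERIV (\<lambda>u. \<Gamma>bar (Suc i) 0 + w \<bullet> u) 0 :> w"
      unfolding gderiv_def by (auto intro!: derivative_eq_intros simp: inner_commute)
    ultimately have "GDERIV (\<Gamma>bar (Suc i)) 0 :> w" by simp
    with der have "(\<lambda>h. h \<bullet> w) = (\<lambda>h. h \<bullet> z (Suc i))"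
      unfolding gderiv_def by (metis has_derivative_unique)
    then have "w = z (Suc i)" by (metis inner_commute vector_eq_ldot)
    with w show ?thesis by blast
  qed
  have "aggregated_cuts p x z (\<lambda>j. \<Gamma>bar j 0)"
    unfolding aggregated_cuts_def
  proof (intro conjI allI impI)
    show "\<Gamma>bar 1 0 + z 1 \<bullet> u = ell f f' p u" for u
      using affz[of 0 u] Gs[of 0 u] by (simp add: x0 G0 algebra_simps)
    fix j :: nat assume "1 \<le> j"
    then obtain i where j: "j = Suc i" by (cases j) auto
    show "ereal (\<Gamma>bar j 0 + z j \<bullet> u) \<le> f u" for u
      using minor[of j u] affz[of i u] by (simp add: j)
    show "x j \<in> minimizers (\<lambda>u. ereal (\<Gamma>bar j 0 + z j \<bullet> u) + hlam h lam p u)"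
      using min[of i] unfolding j by (simp only: affz[of i, symmetric])
    show "\<Gamma>bar j 0 + z j \<bullet> x (Suc j) \<le> \<Gamma>bar (Suc j) 0 + z (Suc j) \<bullet> x (Suc j)"
      using val[of j] unfolding j by (simp only: affz[symmetric])
    show "ell f f' (x j) (x (Suc j)) \<le> \<Gamma>bar (Suc j) 0 + z (Suc j) \<bullet> x (Suc j)"
      using val[of j] unfolding j by (simp only: affz[symmetric])
  qed (rule x0)
  then show ?thesis by blast
qed

text \<open>The minorants are the multiplier-weighted sums \<open>A j\<close> of the cuts in the bundle. Discarding cuts
  with zero multiplier leaves \<open>A j\<close> unchanged, so \<open>A j\<close> is still a convex combination of cuts in the
  next bundle and is dominated by the next model, whose value at the next iterate is that of
  \<open>A (j + 1)\<close>.\<close>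

lemma multi_cuts_aggregated:
  assumes cg: "multi_cuts_cg f f' h lam p x z" and p: "p \<in> edom h"
  shows "\<exists>b. aggregated_cuts p x z b"
proof -
  obtain \<Gamma> I \<theta> zbar where x0: "x 0 = p" and I1: "I 1 = {0}" and zb0: "zbar 0 = f' p"
    and z1: "z 1 = f' p"
    and step: "\<forall>j\<ge>1. let c = (\<lambda>i. ell f f' (x i)) in
           \<Gamma> j = (\<lambda>u. Max ((\<lambda>i. c i u) ` I j)) \<and>
           cut_solution h lam p (I j) c (x j, \<Gamma> j (x j)) \<and>
           (\<Sum>i\<in>I j. \<theta> j i) = 1 \<and>
           cut_multipliers h lam p (I j) c (x j, \<Gamma> j (x j)) (\<theta> j) \<and>
           z j = (\<Sum>i\<in>I j. \<theta> j i *\<^sub>R zbar i) \<and>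
           zbar j = f' (x j) \<and>
           I (j + 1) = {i \<in> I j. \<theta> j i > 0} \<union> {j}"
    using cg unfolding multi_cuts_cg_def by (elim exE conjE) blast
  have sum1: "(\<Sum>i\<in>I j. \<theta> j i) = 1"
    and mult: "cut_multipliers h lam p (I j) (\<lambda>i. ell f f' (x i))
      (x j, Max ((\<lambda>i. ell f f' (x i) (x j)) ` I j)) (\<theta> j)"
    and zj: "z j = (\<Sum>i\<in>I j. \<theta> j i *\<^sub>R zbar i)"
    and IS: "I (Suc j) = {i \<in> I j. \<theta> j i > 0} \<union> {j}" if "j \<ge> 1" for j
    using step[rule_format, of j] that by (auto simp: Let_def)
  have zb: "zbar j = f' (x j)" for j
    using step[rule_format, of j] zb0 x0 by (cases "j = 0") (auto simp: Let_def)
  have finI: "finite (I j)" if "j \<ge> 1" for j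
    using that by (induction j rule: dec_induct) (use I1 IS in auto)
  define A where "A j u = (\<Sum>i\<in>I j. \<theta> j i * ell f f' (x i) u)" for j u
  have min: "x j \<in> minimizers (\<lambda>u. ereal (A j u) + hlam h lam p u)"
    and val: "A j (x j) = Max ((\<lambda>i. ell f f' (x i) (x j)) ` I j)"
    and nonneg: "\<And>i. i \<in> I j \<Longrightarrow> 0 \<le> \<theta> j i" if "j \<ge> 1" for j
    using cut_multipliers_aggregate[OF mult sum1] that by (simp_all add: A_def)
  have xd: "x j \<in> edom h" for j
    using real_model_minimizer_in_edom[OF min, of j] p x0 by (cases "j = 0") auto
  have le: "A j u \<le> r" if "j \<ge> 1" and "\<And>i. i \<in> I j \<Longrightarrow> \<theta> j i > 0 \<Longrightarrow> ell f f' (x i) u \<le> r" for j u r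
  proof -
    have "A j u \<le> (\<Sum>i\<in>I j. \<theta> j i * r)"
      unfolding A_def
    proof (rule sum_mono)
      fix i assume i: "i \<in> I j"
      show "\<theta> j i * ell f f' (x i) u \<le> \<theta> j i * r"
        using that(2)[OF i] nonneg[OF that(1) i] by (cases "\<theta> j i = 0") (auto intro: mult_left_mono)
    qed
    also have "\<dots> = r" using sum1[OF that(1)] by (simp flip: sum_distrib_right)
    finally show ?thesis .
  qed
  have cut_le: "ell f f' (x i) (x j) \<le> A j (x j)" if "j \<ge> 1" "i \<in> I j" for i j
    using that by (simp add: val finI)
  have aff: "A j u = A j 0 + z j \<bullet> u" if "j \<ge> 1" for j u
  proof -
    have "A j u = (\<Sum>i\<in>I j. \<theta> j i * ell f f' (x i) 0 + (\<theta> j i *\<^sub>R zbar i) \<bullet> u)"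
      unfolding A_def by (subst ell_affine) (simp add: zb algebra_simps)
    then show ?thesis
      by (simp add: A_def zj[OF that] sum.distrib inner_sum_left)
  qed
  have "aggregated_cuts p x z (\<lambda>j. A j 0)"
    unfolding aggregated_cuts_def
  proof (intro conjI allI impI)
    show "A 1 0 + z 1 \<bullet> u = ell f f' p u" for u
    proof -
      have "A 1 0 = ell f f' p 0" using sum1[of 1] unfolding A_def I1 by (simp add: x0)
      then show ?thesis using ell_affine[of f f' p u] by (simp only: z1)
    qed
    fix j :: nat assume j: "1 \<le> j"
    show "ereal (A j 0 + z j \<bullet> u) \<le> f u" for u
    proof (cases "f u")
      case (real r)
      have "A j u \<le> r"
        using ell_minorant[OF xd, of _ u] by (intro le[OF j]) (simp add: real)
      then show ?thesis by (simp add: real aff[OF j, symmetric])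
    qed auto
    show "x j \<in> minimizers (\<lambda>u. ereal (A j 0 + z j \<bullet> u) + hlam h lam p u)"
      using min[OF j] by (simp only: aff[OF j, symmetric])
    have S: "Suc j \<ge> 1" by simp
    have "A j (x (Suc j)) \<le> A (Suc j) (x (Suc j))"
      by (intro le[OF j] cut_le[OF S]) (simp add: IS[OF j])
    then show "A j 0 + z j \<bullet> x (Suc j) \<le> A (Suc j) 0 + z (Suc j) \<bullet> x (Suc j)"
      by (simp only: aff[OF j, symmetric] aff[OF S, symmetric])
    have "ell f f' (x j) (x (Suc j)) \<le> A (Suc j) (x (Suc j))"
      by (intro cut_le[OF S]) (simp add: IS[OF j])
    then show "ell f f' (x j) (x (Suc j)) \<le> A (Suc j) 0 + z (Suc j) \<bullet> x (Suc j)"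
      by (simp only: aff[OF S, symmetric])
  qed (rule x0)
  then show ?thesis by blast
qed

section \<open>The primal-dual gap\<close>

text \<open>The conjugate reverses order: \<open>f \<ge> b + \<langle>z, \<cdot>\<rangle>\<close> gives \<open>f\<^sup>*(z) \<le> - b\<close>, and a lower bound \<open>m\<close> for
  \<open>b + \<langle>z, \<cdot>\<rangle> + h\<^sup>\<lambda>\<close> gives \<open>(h\<^sup>\<lambda>)\<^sup>*(- z) \<le> b - m\<close>; the intercepts cancel.\<close>

lemma psi_le:
  assumes minor: "\<And>u. ereal (b + z \<bullet> u) \<le> f u"
    and val: "\<And>u. ereal m \<le> ereal (b + z \<bullet> u) + hlam h lam p u"
  shows "psi f h lam p z \<le> ereal (- m)"
proof -
  have "conjugate (hlam h lam p) (- z) \<le> ereal (b - m)"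
    unfolding conjugate_def
  proof (rule SUP_least)
    fix u
    show "ereal (- z \<bullet> u) - hlam h lam p u \<le> ereal (b - m)"
      using val[of u] by (cases "hlam h lam p u") auto
  qed
  moreover have "conjugate f z \<le> ereal (- b)"
    unfolding conjugate_def
  proof (rule SUP_least)
    fix u
    show "ereal (z \<bullet> u) - f u \<le> ereal (- b)"
      using minor[of u] by (cases "f u") auto
  qed
  ultimately have "psi f h lam p z \<le> ereal (b - m) + ereal (- b)"
    unfolding psi_def by (rule add_mono)
  then show ?thesis by simp
qed

text \<open>With \<open>a = \<parallel>y - p\<parallel>\<close> and \<open>D = \<parallel>w - p\<parallel>\<close>, strong convexity of the first model and optimality of
  \<open>w\<close> give \<open>a\<^sup>2 + \<parallel>w - y\<parallel>\<^sup>2 \<le> D\<^sup>2 + 4\<lambda>Ma\<close>. Together with \<open>\<parallel>w - y\<parallel> \<ge> a - D\<close> this leaves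
  \<open>a (a - D) \<le> 2\<lambda>Ma\<close> if \<open>a > D\<close>.\<close>

lemma first_step_length:
  assumes p: "p \<in> edom h" and w: "w \<in> minimizers (phi f h)"
    and min: "y \<in> minimizers (\<lambda>u. ereal (ell f f' p u) + hlam h lam p u)"
  shows "norm (y - p) \<le> norm (w - p) + 2 * lam * M"
proof -
  have yd: "y \<in> edom h" by (rule real_model_minimizer_in_edom[OF min])
  have wd: "w \<in> edom h" using w by (rule phi_minimizer_in_edom)
  define F H where "F u = real_of_ereal (f u)" and "H u = real_of_ereal (h u)" for u
  have FH: "f u = ereal (F u)" "h u = ereal (H u)" if "u \<in> edom h" for u
    using f_eq[OF that] h_eq[OF that] by (simp_all add: F_def H_def)
  let ?c = "1 / (2 * lam)"
  have "econvex (\<lambda>u. ereal (ell f f' p u))"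
    by (subst ell_affine) (rule econvex_affine)
  from model_growth[OF this _ yd _ min, of w]
  have "ell f f' p y + H y + ?c * (norm (y - p))\<^sup>2 + ?c * (norm (w - y))\<^sup>2
      \<le> ell f f' p w + H w + ?c * (norm (w - p))\<^sup>2"
    by (simp add: hlam_def FH[OF yd] FH[OF wd] algebra_simps)
  moreover have "ell f f' p w \<le> F w"
    using ell_minorant[OF p, of w] by (simp add: FH[OF wd])
  moreover have "F w + H w \<le> F y + H y"
    using minimizersD[OF w, of y] by (simp add: phi_def FH[OF yd] FH[OF wd])
  moreover have "F y \<le> ell f f' p y + 2 * M * norm (y - p)"
    using ell_error[OF p yd] by (simp add: F_def)
  ultimately have "?c * ((norm (y - p))\<^sup>2 + (norm (w - y))\<^sup>2)
      \<le> ?c * (norm (w - p))\<^sup>2 + 2 * M * norm (y - p)"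
    by (simp add: algebra_simps)
  then have "2 * lam * (?c * ((norm (y - p))\<^sup>2 + (norm (w - y))\<^sup>2))
      \<le> 2 * lam * (?c * (norm (w - p))\<^sup>2 + 2 * M * norm (y - p))"
    using lam by (intro mult_left_mono) auto
  then have main: "(norm (y - p))\<^sup>2 + (norm (w - y))\<^sup>2 \<le> (norm (w - p))\<^sup>2 + 4 * lam * M * norm (y - p)"
    using lam by (simp add: distrib_left)
  show ?thesis
  proof (rule ccontr)
    assume far: "\<not> ?thesis"
    define a D where "a = norm (y - p)" and "D = norm (w - p)"
    have lM: "0 < lam * M" using lam M_pos by simp
    have aD: "D + 2 * lam * M < a" "0 \<le> D" using far by (auto simp: a_def D_def)
    have "a \<le> D + norm (w - y)"
      unfolding a_def D_def using norm_triangle_ineq4[of "w - p" "w - y"] by simp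
    then have "(a - D)\<^sup>2 \<le> (norm (w - y))\<^sup>2"
      using aD lM by (intro power_mono) auto
    with main have "a\<^sup>2 + (a - D)\<^sup>2 \<le> D\<^sup>2 + 4 * lam * M * a"
      by (simp add: a_def D_def)
    then have "a * (a - D) \<le> a * (2 * lam * M)"
      by (simp add: power2_eq_square algebra_simps)
    moreover have "0 < a" using aD lM by simp
    ultimately show False using aD by simp
  qed
qed

text \<open>The induction bounds \<open>philam (xt j)\<close> by \<open>m j + B j\<close>, where \<open>m j\<close> is the minimum of the
  aggregated model and \<open>B j\<close> the claimed bound; by weak duality \<open>m j \<le> - \<psi> (z j)\<close>.\<close>

lemma aggregated_cuts_gap:
  assumes cuts: "aggregated_cuts p x z b" and p: "p \<in> edom h"
    and xt1: "xt 1 = x 1"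
    and xt_step: "\<And>i. i \<ge> 1 \<Longrightarrow> philam f h lam p (xt (i + 1))
          \<le> ereal (real i / real (i + 2)) * philam f h lam p (xt i)
            + ereal (2 / real (i + 2)) * philam f h lam p (x (i + 1))"
    and j: "j \<ge> 1"
  shows "philam f h lam p (xt j) + psi f h lam p (z j)
      \<le> ereal (4 * M * norm (x 1 - p) / (real j * (real j + 1)) + 16 * lam * M\<^sup>2 / (real j + 1))"
proof -
  have x0: "x 0 = p" and A1: "b 1 + z 1 \<bullet> u = ell f f' p u" for u
    using cuts unfolding aggregated_cuts_def by blast+
  have minor: "ereal (b i + z i \<bullet> u) \<le> f u"
    and min: "x i \<in> minimizers (\<lambda>u. ereal (b i + z i \<bullet> u) + hlam h lam p u)"
    and mono: "b i + z i \<bullet> x (Suc i) \<le> b (Suc i) + z (Suc i) \<bullet> x (Suc i)"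
    and newest: "ell f f' (x i) (x (Suc i)) \<le> b (Suc i) + z (Suc i) \<bullet> x (Suc i)"
    if "i \<ge> 1" for i u
    using cuts that unfolding aggregated_cuts_def by blast+
  have xd: "x i \<in> edom h" for i
    using real_model_minimizer_in_edom[OF min, of i] p x0 by (cases "i = 0") auto
  define F where "F u = real_of_ereal (f u)" for u
  define H where "H u = real_of_ereal (h u) + 1 / (2 * lam) * (norm (u - p))\<^sup>2" for u
  define m where "m i = b i + z i \<bullet> x i + H (x i)" for i
  have Fx: "f (x i) = ereal (F (x i))" for i
    using f_eq[OF xd] by (simp add: F_def)
  have Hx: "hlam h lam p (x i) = ereal (H (x i))" for i
    unfolding hlam_def by (subst h_eq[OF xd]) (simp add: H_def)
  have phx: "philam f h lam p (x i) = ereal (F (x i) + H (x i))" for i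
    by (simp add: philam_def Fx Hx)
  define B where "B i = 4 * M * norm (x 1 - p) / (real i * (real i + 1)) + 16 * lam * M\<^sup>2 / (real i + 1)" for i
  have primal: "philam f h lam p (xt j) \<le> ereal (m j + B j)"
    using j
  proof (induction j rule: dec_induct)
    case base
    have "F (x 1) \<le> ell f f' p (x 1) + 2 * M * norm (x 1 - p)"
      using ell_error[OF p xd] by (simp add: F_def)
    also have "\<dots> = b 1 + z 1 \<bullet> x 1 + 2 * M * norm (x 1 - p)"
      by (simp only: A1)
    finally have "F (x 1) + H (x 1) \<le> m 1 + 2 * M * norm (x 1 - p)"
      by (simp add: m_def)
    also have "\<dots> \<le> m 1 + B 1"
      using lam by (simp add: B_def)
    finally show ?case by (simp only: xt1 phx ereal_less_eq)
  next
    case (step i)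
    define \<tau> where "\<tau> = real i / real (i + 2)"
    have i: "real i \<ge> 1" using step by simp
    have \<tau>: "0 < \<tau>" "\<tau> < 1" "2 / real (i + 2) = 1 - \<tau>"
      using i by (simp_all add: \<tau>_def field_simps)
    define d where "d = norm (x (Suc i) - x i)"
    let ?y = "x (Suc i)"
    have "m i + 1 / (2 * lam) * d\<^sup>2 \<le> b i + z i \<bullet> ?y + H ?y"
      using model_growth[OF econvex_affine _ xd _ min[OF step(1)], of ?y]
      by (simp add: Hx m_def d_def)
    also have "\<dots> \<le> m (Suc i)"
      using mono[OF step(1)] by (simp add: m_def)
    finally have old: "m i + 1 / (2 * lam) * d\<^sup>2 \<le> m (Suc i)" .
    have new: "F ?y + H ?y - 2 * M * d \<le> m (Suc i)"
      using ell_error[OF xd[of i] xd[of "Suc i"]] newest[OF step(1)]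
      by (simp add: m_def F_def d_def)
    have "\<tau> * (m i + 1 / (2 * lam) * d\<^sup>2) + (1 - \<tau>) * (F ?y + H ?y - 2 * M * d) \<le> m (Suc i)"
      by (intro convex_bound_le old new) (use \<tau> in auto)
    then have comb: "\<tau> * m i + (1 - \<tau>) * (F ?y + H ?y)
        \<le> m (Suc i) + ((1 - \<tau>) * 2 * M * d - \<tau> / (2 * lam) * d\<^sup>2)"
      by (simp add: algebra_simps)
    \<comment> \<open>The worst step length is \<open>d = 2\<lambda>M(1 - \<tau>)/\<tau>\<close>; completing the square around it.\<close>
    have quad: "(1 - \<tau>) * 2 * M * d - \<tau> / (2 * lam) * d\<^sup>2 \<le> 2 * lam * M\<^sup>2 * (1 - \<tau>)\<^sup>2 / \<tau>"
    proof -
      have "0 \<le> (\<tau> * d - 2 * lam * M * (1 - \<tau>))\<^sup>2 / (2 * lam * \<tau>)"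
        using lam \<tau> by simp
      also have "\<dots> = 2 * lam * M\<^sup>2 * (1 - \<tau>)\<^sup>2 / \<tau> - ((1 - \<tau>) * 2 * M * d - \<tau> / (2 * lam) * d\<^sup>2)"
        using lam \<tau> by (simp add: power2_eq_square field_simps)
      finally show ?thesis by simp
    qed
    \<comment> \<open>Up to the factor \<open>(i + 1) (i + 2)\<close>, this is \<open>8\<lambda>M\<^sup>2 (i + 1) / i \<le> 16\<lambda>M\<^sup>2\<close>, valid as \<open>i \<ge> 1\<close>.\<close>
    have rec: "\<tau> * B i + 2 * lam * M\<^sup>2 * (1 - \<tau>)\<^sup>2 / \<tau> \<le> B (Suc i)"
    proof -
      have "2 * lam * M\<^sup>2 * (1 - \<tau>)\<^sup>2 / \<tau> = 8 * (lam * M\<^sup>2) / (real i * (real i + 2))"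
      proof -
        have "2 * lam * M\<^sup>2 * (2 / r)\<^sup>2 / (q / r) = 8 * (lam * M\<^sup>2) / (q * r)"
          if "0 < q" "0 < r" for q r :: real
          using that by (simp add: field_simps power2_eq_square)
        from this[of "real i" "real (i + 2)"] show ?thesis
          using i unfolding \<tau>(3) \<tau>_def[symmetric] by (simp add: add.commute)
      qed
      also have "\<dots> \<le> 16 * (lam * M\<^sup>2) / ((real i + 1) * (real i + 2))"
      proof -
        have "8 * (lam * M\<^sup>2) * (real i + 1) \<le> 16 * (lam * M\<^sup>2) * real i"
          using i lam M_pos by (simp add: algebra_simps)
        then show ?thesis using i by (simp add: divide_simps)
      qed
      finally have e: "2 * lam * M\<^sup>2 * (1 - \<tau>)\<^sup>2 / \<tau> \<le> 16 * (lam * M\<^sup>2) / ((real i + 1) * (real i + 2))" .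
      have shrink: "n / (n + 2) * (K / (n * (n + 1)) + L / (n + 1))
          = K / ((n + 1) * (n + 2)) + L * n / ((n + 1) * (n + 2))"
        if "0 < n" for n K L :: real
      proof -
        have "n / (n + 2) * (K / (n * (n + 1))) = K / ((n + 1) * (n + 2))"
          using that by simp
        then show ?thesis by (simp add: distrib_left mult.commute)
      qed
      have split: "L / (n + 2) = L * n / ((n + 1) * (n + 2)) + L / ((n + 1) * (n + 2))"
        if "0 < n" for n L :: real
      proof -
        have "L * n / ((n + 1) * (n + 2)) + L / ((n + 1) * (n + 2)) = L * (n + 1) / ((n + 1) * (n + 2))"
          by (simp add: distrib_left add_divide_distrib)
        with that show ?thesis by simp
      qed
      define K where "K = 4 * M * norm (x 1 - p)"
      have "\<tau> * B i = K / ((real i + 1) * (real i + 2))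
          + 16 * (lam * M\<^sup>2) * real i / ((real i + 1) * (real i + 2))"
        using shrink[of "real i" K "16 * (lam * M\<^sup>2)"] i
        by (simp add: B_def \<tau>_def K_def mult.assoc add.commute[of 2])
      moreover have "B (Suc i) = K / ((real i + 1) * (real i + 2))
          + 16 * (lam * M\<^sup>2) * real i / ((real i + 1) * (real i + 2))
          + 16 * (lam * M\<^sup>2) / ((real i + 1) * (real i + 2))"
        using split[of "real i" "16 * (lam * M\<^sup>2)"] i
        by (simp add: B_def K_def mult.assoc add.commute)
      ultimately show ?thesis using e by linarith
    qed
    have "philam f h lam p (xt (i + 1))
        \<le> ereal \<tau> * philam f h lam p (xt i) + ereal (1 - \<tau>) * philam f h lam p (x (i + 1))"
      using xt_step[OF step(1)] by (simp only: \<tau>(3) \<tau>_def[symmetric])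
    also have "\<dots> \<le> ereal \<tau> * ereal (m i + B i) + ereal (1 - \<tau>) * ereal (F ?y + H ?y)"
      using step.IH \<tau> by (intro add_mono ereal_mult_left_mono) (auto simp: phx)
    also have "\<dots> = ereal ((\<tau> * m i + (1 - \<tau>) * (F ?y + H ?y)) + \<tau> * B i)"
      by (simp add: algebra_simps)
    also have "\<dots> \<le> ereal (m (Suc i) + B (Suc i))"
      using comb quad rec by simp
    finally show ?case by simp
  qed
  have "psi f h lam p (z j) \<le> ereal (- m j)"
  proof (rule psi_le)
    show "ereal (b j + z j \<bullet> u) \<le> f u" for u by (rule minor[OF j])
    show "ereal (m j) \<le> ereal (b j + z j \<bullet> u) + hlam h lam p u" for u
      using minimizersD[OF min[OF j], of u] by (simp add: Hx m_def)
  qed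
  with primal have "philam f h lam p (xt j) + psi f h lam p (z j) \<le> ereal (m j + B j) + ereal (- m j)"
    by (rule add_mono)
  then show ?thesis by (simp add: B_def)
qed

end

theorem theorem3p4:
  fixes f h :: "'a::euclidean_space \<Rightarrow> ereal"
    and f' :: "'a \<Rightarrow> 'a"
    and M lam eps d0 :: real
    and xh0 :: 'a
    and xh xth sh :: "nat \<Rightarrow> 'a"
    and x xt z :: "nat \<Rightarrow> 'a"
    and k j :: nat
  assumes f: "proper_lsc_convex f"
    and h: "proper_lsc_convex h"
    and dom: "edom h \<subseteq> edom f"
    and subgrad: "\<forall>y\<in>edom h. f' y \<in> subdiff f y"
    and M_pos: "M > 0"
    and bounded: "\<forall>y\<in>edom h. norm (f' y) \<le> M"
    and solvable: "minimizers (phi f h) \<noteq> {}"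
    and xh0: "xh0 \<in> edom h"
    and d0: "d0 = infdist xh0 (minimizers (phi f h))"
    and lam: "lam > 0"
    and eps: "eps > 0"
    and k: "k \<ge> 1" "real k \<le> 2 * d0\<^sup>2 / (lam * eps)"
    and pdpb: "pdpb f f' h lam eps xh0 (k - 1) xh xth sh"
    and cg: "two_cuts_cg f f' h lam (xh (k - 1)) x z \<or> multi_cuts_cg f f' h lam (xh (k - 1)) x z"
    and xt1: "xt 1 = x 1"
    and xt_step: "\<forall>i\<ge>1. philam f h lam (xh (k - 1)) (xt (i + 1))
          \<le> ereal (real i / real (i + 2)) * philam f h lam (xh (k - 1)) (xt i)
            + ereal (2 / real (i + 2)) * philam f h lam (xh (k - 1)) (x (i + 1))"
    and j: "j \<ge> 1"
  shows "philam f h lam (xh (k - 1)) (xt j) + psi f h lam (xh (k - 1)) (z j)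
      \<le> ereal (8 * M * (3 * d0 + lam * M) / (real j * (real j + 1))
               + 16 * lam * M\<^sup>2 / (real j + 1))"
proof -
  interpret lipschitz_composite f h f' M lam
    using f h dom subgrad bounded M_pos lam by unfold_locales auto
  define p where "p = xh (k - 1)"
  obtain w where w: "w \<in> minimizers (phi f h)" and dw: "d0 = norm (w - xh0)"
    using infdist_minimizers_attained[OF f h solvable, of xh0] d0 by metis
  have p: "p \<in> edom h"
    and dist: "(norm (w - p))\<^sup>2 \<le> d0\<^sup>2 + 2 * lam * eps * real (k - 1)"
    using pdpb_centers[OF pdpb xh0 w order_refl] by (auto simp: p_def dw)
  have "2 * lam * eps * real (k - 1) \<le> 2 * lam * eps * real k"
    using lam eps by (intro mult_left_mono) auto
  moreover have "2 * lam * eps * real k \<le> 4 * d0\<^sup>2"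
    using k(2) lam eps by (simp add: field_simps)
  moreover have "(6 * d0)\<^sup>2 = 36 * d0\<^sup>2" "0 \<le> d0\<^sup>2"
    by (simp_all add: power_mult_distrib)
  ultimately have "(norm (w - p))\<^sup>2 \<le> (6 * d0)\<^sup>2"
    using dist by linarith
  then have D: "norm (w - p) \<le> 6 * d0"
    by (rule power2_le_imp_le) (simp add: dw)
  obtain b where cuts: "aggregated_cuts p x z b"
    using cg two_cuts_aggregated multi_cuts_aggregated p unfolding p_def by blast
  then have "x 1 \<in> minimizers (\<lambda>u. ereal (ell f f' p u) + hlam h lam p u)"
    unfolding aggregated_cuts_def by (metis (no_types, lifting) order_refl ext)
  from first_step_length[OF p w this] D have "norm (x 1 - p) \<le> 6 * d0 + 2 * lam * M"
    by linarith
  then have "4 * M * norm (x 1 - p) \<le> 4 * M * (6 * d0 + 2 * lam * M)"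
    using M_pos by (intro mult_left_mono) auto
  also have "\<dots> = 8 * M * (3 * d0 + lam * M)"
    by (simp add: algebra_simps)
  finally have "4 * M * norm (x 1 - p) / (real j * (real j + 1)) + 16 * lam * M\<^sup>2 / (real j + 1)
      \<le> 8 * M * (3 * d0 + lam * M) / (real j * (real j + 1)) + 16 * lam * M\<^sup>2 / (real j + 1)"
    by (intro add_right_mono divide_right_mono) auto
  then show ?thesis
    using aggregated_cuts_gap[of p x z b xt j, OF cuts p xt1 _ j] xt_step
    unfolding p_def[symmetric] by (auto intro: order_trans)
qed

end
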